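(* Let $F$ be a plane forest with $n$ vertices and let $w$ be a signed labeling of $F$ on $\{1,2,\ldots,n\}$. Then, as formal power series in $x$, \[ \frac{\sum_{\sigma\in\mathcal{L}(F,w)}x^{\mathrm{des}_B(\sigma)}}{(1-x)^{n+1}}=\sum_{t\ge0}\Omega_F(w,t)\,x^t. \]
   Context: A plane forest $F$ is partially ordered by $x<_F y$ iff $y$ is a proper ancestor of $x$. In particular, the roots are the maximal elements. A signed labeling of $F$ on $\{1,\ldots,n\}$ assigns to each vertex $x$ a label $w(x)\in\{\pm1,\ldots,\pm n\}$ so that $x\mapsto|w(x)|$ is a bijection onto $\{1,\ldots,n\}$. A linear extension of $F$ is an ordering $x_1\cdots x_n$ of its vertices such that $x_j<_F x_k$ implies $j<k$. $\mathcal{L}(F,w)$ is the set of words $w(x_1)\cdots w(x_n)$ over the linear extensions $x_1\cdots x_n$ of $F$. For a word $\sigma=\sigma_1\cdots\sigma_n$ of nonzero integers, define $\mathrm{Des}_B(\sigma)=\{i:1\le i\le n-1,\ \sigma_i>\sigma_{i+1}\}\cup\{n\text{ if }\sigma_n>0\}$ and $\mathrm{des}_B(\sigma)=|\mathrm{Des}_B(\sigma)|$. A type $B$ $(F,w)$-partition is a map $f$ from the vertices of $F$ to $\mathbb{N}=\{0,1,2,\ldots\}$ satisfying three conditions: (1) $f(x)\le f(y)$ whenever $x\ge_F y$; (2) $f(x)<f(y)$ whenever $x>_F y$ and $w(x)<w(y)$; (3) $f(x)\ge1$ whenever $x$ is a root with $w(x)>0$. For $t\in\mathbb{N}$, $\Omega_F(w,t)$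 denotes the number of type $B$ $(F,w)$-partitions $f$ with $f(x)\le t$ for all vertices $x$. *)

theory Defs
  imports
    "HOL-Library.Sublist"
    "HOL-Library.FuncSet"
    "HOL-Computational_Algebra.Formal_Power_Series"
begin

datatype plane_tree = Node (children: "plane_tree list")

type_synonym plane_forest = "plane_tree list"

text \<open>
  A vertex is encoded by its address: the nonempty list \<open>[i\<^sub>0, \<dots>, i\<^sub>k]\<close> is the vertex reached from
  the root of the \<open>i\<^sub>0\<close>-th tree by descending to the \<open>i\<^sub>1\<close>-th child, and so on (counting from 0).
  Hence the proper ancestors of a vertex are its proper nonempty prefixes.
\<close>

type_synonym vertex = "nat list"

inductive is_vertex :: "plane_forest \<Rightarrow> vertex \<Rightarrow> bool" where
  root: "i < length F \<Longrightarrow> is_vertex F [i]"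
| below: "i < length F \<Longrightarrow> is_vertex (children (F ! i)) p \<Longrightarrow> is_vertex F (i # p)"

definition vertices :: "plane_forest \<Rightarrow> vertex set" where
  "vertices F = {p. is_vertex F p}"

definition roots :: "plane_forest \<Rightarrow> vertex set" where
  "roots F = {[i] | i. i < length F}"

definition forest_less :: "plane_forest \<Rightarrow> vertex \<Rightarrow> vertex \<Rightarrow> bool" where
  "forest_less F x y \<longleftrightarrow> x \<in> vertices F \<and> y \<in> vertices F \<and> strict_prefix y x"

definition forest_le :: "plane_forest \<Rightarrow> vertex \<Rightarrow> vertex \<Rightarrow> bool" where
  "forest_le F x y \<longleftrightarrow> x \<in> vertices F \<and> y \<in> vertices F \<and> (x = y \<or> forest_less F x y)"

definition signed_labeling :: "plane_forest \<Rightarrow> nat \<Rightarrow> (vertex \<Rightarrow> int) \<Rightarrow> bool" where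
  "signed_labeling F n w \<longleftrightarrow>
     (\<forall>x \<in> vertices F. w x \<in> {- int n..int n} - {0}) \<and>
     bij_betw (\<lambda>x. \<bar>w x\<bar>) (vertices F) {1..int n}"

definition linear_extensions :: "plane_forest \<Rightarrow> vertex list set" where
  "linear_extensions F =
     {xs. distinct xs \<and> set xs = vertices F \<and>
          (\<forall>j < length xs. \<forall>k < length xs. forest_less F (xs ! j) (xs ! k) \<longrightarrow> j < k)}"

definition linear_extension_words :: "plane_forest \<Rightarrow> (vertex \<Rightarrow> int) \<Rightarrow> int list set" where
  "linear_extension_words F w = map w ` linear_extensions F"

text \<open>Descent positions are counted from 1, whereas \<open>!\<close> counts from 0.\<close>

definition Des_B :: "int list \<Rightarrow> nat set" where
  "Des_B \<sigma> =
     {i. 1 \<le> i \<and> i < length \<sigma> \<and> \<sigma> ! (i - 1) > \<sigma> ! i} \<union>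
     {i. i = length \<sigma> \<and> \<sigma> \<noteq> [] \<and> last \<sigma> > 0}"

definition des_B :: "int list \<Rightarrow> nat" where
  "des_B \<sigma> = card (Des_B \<sigma>)"

text \<open>
  Maps on the vertices are taken to be extensional, so that each of them is counted exactly once.
\<close>

definition type_B_partitions :: "plane_forest \<Rightarrow> (vertex \<Rightarrow> int) \<Rightarrow> (vertex \<Rightarrow> nat) set" where
  "type_B_partitions F w =
     {f \<in> vertices F \<rightarrow>\<^sub>E UNIV.
        (\<forall>x y. forest_le F y x \<longrightarrow> f x \<le> f y) \<and>
        (\<forall>x y. forest_less F y x \<and> w x < w y \<longrightarrow> f x < f y) \<and>
        (\<forall>x \<in> roots F. w x > 0 \<longrightarrow> f x \<ge> 1)}"

definition Omega :: "plane_forest \<Rightarrow> (vertex \<Rightarrow> int) \<Rightarrow> nat \<Rightarrow> nat" where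
  "Omega F w t = card {f \<in> type_B_partitions F w. \<forall>x \<in> vertices F. f x \<le> t}"

lemma vertices_unfold:
  "vertices F = (\<Union>i < length F. insert [i] ((#) i ` vertices (children (F ! i))))"
proof (rule set_eqI)
  fix p
  show "p \<in> vertices F \<longleftrightarrow>
        p \<in> (\<Union>i < length F. insert [i] ((#) i ` vertices (children (F ! i))))"
    unfolding vertices_def mem_Collect_eq by (subst is_vertex.simps) auto
qed

lemma finite_vertices: "finite (vertices F)"
proof (induction "size_list size F" arbitrary: F rule: less_induct)
  case less
  have "finite (vertices (children (F ! i)))" if "i < length F" for i
  proof (rule less)
    have "size_list size (children (F ! i)) < size (F ! i)"
      by (cases "F ! i") simp
    also have "\<dots> \<le> size_list size F"
      using that by (intro size_list_estimation'[of "F ! i"]) auto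
    finally show "size_list size (children (F ! i)) < size_list size F" .
  qed
  then show ?case
    by (subst vertices_unfold) auto
qed

lemma roots_eq_maximal: "roots F = {x \<in> vertices F. \<not> (\<exists>y. forest_less F x y)}"
proof (rule set_eqI)
  fix x
  have nonempty: "p \<noteq> []" if "is_vertex F p" for p
    using that by cases auto
  have iff: "x \<in> roots F \<longleftrightarrow> (\<exists>i. x = [i] \<and> i < length F)"
    by (auto simp: roots_def)
  show "x \<in> roots F \<longleftrightarrow> x \<in> {x \<in> vertices F. \<not> (\<exists>y. forest_less F x y)}"
  proof
    assume "x \<in> roots F"
    then obtain i where i: "x = [i]" "i < length F"
      using iff by blast
    have "\<not> forest_less F x y" for y
    proof
      assume "forest_less F x y"
      then have "is_vertex F y" and "strict_prefix y x"
        by (auto simp: forest_less_def vertices_def)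
      then show False
        using nonempty[of y] i by (cases y) (auto simp: strict_prefix_def)
    qed
    then show "x \<in> {x \<in> vertices F. \<not> (\<exists>y. forest_less F x y)}"
      using i by (auto simp: vertices_def intro: is_vertex.root)
  next
    assume "x \<in> {x \<in> vertices F. \<not> (\<exists>y. forest_less F x y)}"
    then have x: "is_vertex F x" and max: "\<not> forest_less F x y" for y
      by (auto simp: vertices_def)
    from x obtain i p where ip: "x = i # p" "i < length F"
      by cases auto
    have "is_vertex F [i]"
      using ip(2) by (rule is_vertex.root)
    then have "\<not> strict_prefix [i] x"
      using max[of "[i]"] x by (simp add: forest_less_def vertices_def)
    then have "p = []"
      using ip(1) by (auto simp: strict_prefix_def)
    then show "x \<in> roots F"
      using iff ip by blast
  qed
qed

end

theory Submission
  imports Defs "HOL-Library.Product_Lexorder"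
begin

text \<open>
  Order the vertices by the key \<open>(- f x, w x)\<close>, compared lexicographically. A map \<open>f\<close> is a type B
  partition iff its key is monotone along the forest and bounded by \<open>(0, 0)\<close>, which acts as the key
  of an extra vertex on top of all the roots. As \<open>w\<close> is injective, exactly one ordering of the
  vertices sorts the keys of \<open>f\<close>, and \<open>f\<close> is a type B partition iff that ordering is a linear
  extension. For a fixed linear extension with label word \<open>\<sigma>\<close> one counts sequences
  \<open>t \<ge> v\<^sub>1 \<ge> \<dots> \<ge> v\<^sub>n \<ge> 0\<close> with strict inequalities at the type B descents of \<open>\<sigma>\<close>. Adding a letter in
  front divides their generating function by \<open>1 - x\<close> and multiplies it by \<open>x\<close> at a descent.
\<close>

section \<open>Type B descents of words\<close>

text \<open>The value 0 on \<open>[]\<close> is the convention that a word is followed by the letter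
  0; the special descent of \<open>Des_B\<close> at a positive last letter is then an ordinary
  one.\<close>

definition head_or_zero :: "'a::zero list \<Rightarrow> 'a" where
  "head_or_zero xs = (case xs of [] \<Rightarrow> 0 | x # _ \<Rightarrow> x)"

lemma head_or_zero_simps [simp]:
  "head_or_zero [] = 0" "head_or_zero (x # xs) = x"
  by (simp_all add: head_or_zero_def)

lemma des_B_Nil: "des_B [] = 0"
  by (simp add: des_B_def Des_B_def)

text \<open>A new first letter shifts the old positions by one and adds a single comparison, at
  position 1.\<close>

lemma Des_B_Cons:
  "Des_B (s # \<sigma>) = Suc ` Des_B \<sigma> \<union> (if head_or_zero \<sigma> < s then {1} else {})"
proof (rule set_eqI)
  fix i
  show "i \<in> Des_B (s # \<sigma>) \<longleftrightarrow>
    i \<in> Suc ` Des_B \<sigma> \<union> (if head_or_zero \<sigma> < s then {1} else {})"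
  proof (cases i)
    case 0
    then show ?thesis by (auto simp: Des_B_def)
  next
    case (Suc j)
    then show ?thesis
      by (cases \<sigma>; cases j) (auto simp: Des_B_def image_iff)
  qed
qed

lemma des_B_Cons:
  "des_B (s # \<sigma>) = of_bool (head_or_zero \<sigma> < s) + des_B \<sigma>"
proof -
  have fin: "finite (Des_B \<sigma>)"
    by (rule finite_subset[of _ "{..length \<sigma>}"]) (auto simp: Des_B_def)
  have "1 \<notin> Suc ` Des_B \<sigma>"
    by (auto simp: Des_B_def)
  then show ?thesis
    using fin by (simp add: des_B_def Des_B_Cons card_image)
qed

section \<open>Value sequences compatible with a word\<close>

text \<open>Lexicographic order on the pairs makes the values weakly decreasing, strictly at each
  descent. The final \<open>(0, 0)\<close> forces the last value to be positive when the last letter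
  is.\<close>

definition compatible_values :: "int list \<Rightarrow> nat \<Rightarrow> nat list set" where
  "compatible_values \<sigma> t = {vs. length vs = length \<sigma> \<and> (\<forall>v \<in> set vs. v \<le> t) \<and>
     sorted (zip (map (\<lambda>v. - int v) vs) \<sigma> @ [(0, 0)])}"

lemma finite_compatible_values: "finite (compatible_values \<sigma> t)"
  by (rule finite_subset[OF _ finite_lists_length_eq[of "{..t}" "length \<sigma>"]])
    (auto simp: compatible_values_def)

lemma compatible_values_Nil: "compatible_values [] t = {[]}"
  by (auto simp: compatible_values_def)

text \<open>Behind the first value \<open>v\<close>, the upper bound \<open>t\<close> tightens to
  \<open>v\<close>, or to \<open>v - 1\<close> at a descent. Subtraction truncates at 0, so
  \<open>v = 0\<close> at a descent is excluded by a separate inequality.\<close>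

lemma Cons_mem_compatible_values:
  "v # vs \<in> compatible_values (s # \<sigma>) t \<longleftrightarrow>
     v \<le> t \<and> of_bool (head_or_zero \<sigma> < s) \<le> v \<and>
     vs \<in> compatible_values \<sigma> (v - of_bool (head_or_zero \<sigma> < s))"
proof (cases \<sigma>)
  case Nil
  then show ?thesis
    by (cases vs) (auto simp: compatible_values_def)
next
  case (Cons s' \<sigma>')
  show ?thesis
  proof (cases vs)
    case Nil
    then show ?thesis
      using Cons by (auto simp: compatible_values_def)
  next
    case (Cons v' vs')
    \<comment> \<open>Sortedness makes \<open>v'\<close> the largest remaining value, so bounding it
      bounds them all.\<close>
    have le_head: "u \<le> v'"
      if "length vs' = length \<sigma>'" "u \<in> set vs'"
        and "sorted (zip (map (\<lambda>v. - int v) (v' # vs')) (s' # \<sigma>') @ [(0, 0)])" for u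
    proof -
      from that(1,2) obtain i where "i < length vs'" "u = vs' ! i"
        by (auto simp: in_set_conv_nth)
      then have "(- int u, \<sigma>' ! i) \<in> set (zip (map (\<lambda>v. - int v) vs') \<sigma>')"
        using that(1) by (auto simp: in_set_zip intro!: exI[of _ i])
      then have "(- int v', s') \<le> (- int u, \<sigma>' ! i)"
        using that(3) by auto
      then show ?thesis by auto
    qed
    let ?L = "zip (map (\<lambda>v. - int v) (v' # vs')) (s' # \<sigma>') @ [(0, 0)]"
    let ?\<delta> = "of_bool (s' < s) :: nat"
    have "v # vs \<in> compatible_values (s # \<sigma>) t \<longleftrightarrow>
      length vs' = length \<sigma>' \<and> v \<le> t \<and> v' \<le> t \<and> (\<forall>u \<in> set vs'. u \<le> t) \<and>
      (- int v, s) \<le> (- int v', s') \<and> sorted ?L"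
      unfolding compatible_values_def Cons \<open>\<sigma> = s' # \<sigma>'\<close> mem_Collect_eq
      by (simp only: list.map zip_Cons_Cons append_Cons sorted2 list.size list.set) auto
    also have "(- int v, s) \<le> (- int v', s') \<longleftrightarrow> ?\<delta> \<le> v \<and> v' \<le> v - ?\<delta>"
      by (cases "s' < s") auto
    also have "length vs' = length \<sigma>' \<and> v \<le> t \<and> v' \<le> t \<and> (\<forall>u \<in> set vs'. u \<le> t) \<and>
        (?\<delta> \<le> v \<and> v' \<le> v - ?\<delta>) \<and> sorted ?L \<longleftrightarrow>
      v \<le> t \<and> ?\<delta> \<le> v \<and> length vs' = length \<sigma>' \<and>
        (v' \<le> v - ?\<delta> \<and> (\<forall>u \<in> set vs'. u \<le> v - ?\<delta>)) \<and> sorted ?L"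
      using le_head by (meson diff_le_self le_trans)
    also have "\<dots> \<longleftrightarrow> v \<le> t \<and> ?\<delta> \<le> v \<and> vs \<in> compatible_values \<sigma> (v - ?\<delta>)"
      unfolding compatible_values_def Cons \<open>\<sigma> = s' # \<sigma>'\<close> mem_Collect_eq
      by (simp only: list.size list.set) auto
    finally show ?thesis
      using \<open>\<sigma> = s' # \<sigma>'\<close> by simp
  qed
qed

text \<open>The count splits by the first value. Zero terms below \<open>\<delta>\<close> make each
  summand a coefficient of the generating function shifted by
  \<open>fps_X ^ \<delta>\<close>.\<close>

lemma card_compatible_values_Cons:
  fixes s :: int and \<sigma> :: "int list"
  defines "\<delta> \<equiv> of_bool (head_or_zero \<sigma> < s) :: nat"
  shows "card (compatible_values (s # \<sigma>) t) =
    (\<Sum>v = 0..t. if v < \<delta> then 0 else card (compatible_values \<sigma> (v - \<delta>)))"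
proof -
  have "compatible_values (s # \<sigma>) t =
    (\<lambda>(v, vs). v # vs) ` (SIGMA v:{\<delta>..t}. compatible_values \<sigma> (v - \<delta>))"
  proof (rule set_eqI)
    fix us
    show "us \<in> compatible_values (s # \<sigma>) t \<longleftrightarrow>
      us \<in> (\<lambda>(v, vs). v # vs) ` (SIGMA v:{\<delta>..t}. compatible_values \<sigma> (v - \<delta>))"
    proof (cases us)
      case Nil
      then show ?thesis by (auto simp: compatible_values_def)
    next
      case (Cons v vs)
      then show ?thesis
        using Cons_mem_compatible_values[of v vs s \<sigma> t] by (auto simp: \<delta>_def image_iff)
    qed
  qed
  moreover have "inj_on (\<lambda>(v, vs). v # vs) (SIGMA v:{\<delta>..t}. compatible_values \<sigma> (v - \<delta>))"
    by (auto simp: inj_on_def)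
  ultimately have "card (compatible_values (s # \<sigma>) t) =
      (\<Sum>v \<in> {\<delta>..t}. card (compatible_values \<sigma> (v - \<delta>)))"
    by (simp add: card_image finite_compatible_values)
  also have "\<dots> = (\<Sum>v = 0..t. if v < \<delta> then 0 else card (compatible_values \<sigma> (v - \<delta>)))"
    by (rule sum.mono_neutral_cong_left) auto
  finally show ?thesis .
qed

lemma compatible_values_fps:
  "Abs_fps (\<lambda>t. of_nat (card (compatible_values \<sigma> t)) :: 'a::field) *
     (1 - fps_X) ^ (length \<sigma> + 1) = fps_X ^ des_B \<sigma>"
proof (induction \<sigma>)
  case Nil
  show ?case
    \<comment> \<open>Every coefficient is 1 here: the series is geometric.\<close>
    by (rule fps_ext) (auto simp: compatible_values_Nil des_B_Nil algebra_simps fps_X_mult_nth)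
next
  case (Cons s \<sigma>)
  let ?\<delta> = "of_bool (head_or_zero \<sigma> < s) :: nat"
  let ?A = "\<lambda>\<sigma>. Abs_fps (\<lambda>t. of_nat (card (compatible_values \<sigma> t)) :: 'a)"
  \<comment> \<open>Division by \<open>1 - fps_X\<close> takes partial sums of coefficients, which
    is the recursion in \<open>t\<close>.\<close>
  have "?A (s # \<sigma>) = (fps_X ^ ?\<delta> * ?A \<sigma>) / (1 - fps_X)"
    unfolding fps_divide_fps_X_minus1_sum
    by (rule fps_ext)
      (auto simp: card_compatible_values_Cons fps_X_power_mult_nth intro!: sum.cong)
  then have "?A (s # \<sigma>) * (1 - fps_X) = fps_X ^ ?\<delta> * ?A \<sigma>"
    by (simp add: fps_divide_unit mult.assoc inverse_mult_eq_1)
  then have "?A (s # \<sigma>) * (1 - fps_X) ^ (length (s # \<sigma>) + 1) =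
      fps_X ^ ?\<delta> * (?A \<sigma> * (1 - fps_X) ^ (length \<sigma> + 1))"
    by (simp add: mult.assoc [symmetric])
  then show ?case
    unfolding Cons.IH des_B_Cons by (simp only: power_add)
qed

section \<open>Maps sorted along a fixed ordering\<close>

definition vertex_key :: "('a \<Rightarrow> int) \<Rightarrow> ('a \<Rightarrow> nat) \<Rightarrow> 'a \<Rightarrow> int \<times> int" where
  "vertex_key w f x = (- int (f x), w x)"

definition sorted_maps :: "('a \<Rightarrow> int) \<Rightarrow> 'a list \<Rightarrow> nat \<Rightarrow> ('a \<Rightarrow> nat) set" where
  "sorted_maps w xs t = {f \<in> set xs \<rightarrow>\<^sub>E UNIV. (\<forall>x \<in> set xs. f x \<le> t) \<and>
     sorted (map (vertex_key w f) xs @ [(0, 0)])}"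

lemma bij_betw_sorted_maps:
  assumes "distinct xs"
  shows "bij_betw (\<lambda>f. map f xs) (sorted_maps w xs t) (compatible_values (map w xs) t)"
proof -
  have zip: "zip (map (\<lambda>v. - int v) (map f xs)) (map w xs) = map (vertex_key w f) xs" for f
    by (simp add: vertex_key_def zip_map_map zip_same_conv_map)
  have "inj_on (\<lambda>f. map f xs) (sorted_maps w xs t)"
    by (rule inj_onI) (auto simp: sorted_maps_def intro: PiE_ext)
  moreover have "(\<lambda>f. map f xs) ` sorted_maps w xs t = compatible_values (map w xs) t"
  proof (intro equalityI subsetI)
    fix vs assume "vs \<in> (\<lambda>f. map f xs) ` sorted_maps w xs t"
    then obtain f where "f \<in> sorted_maps w xs t" "vs = map f xs"
      by auto
    then show "vs \<in> compatible_values (map w xs) t"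
      using zip[of f] by (auto simp: sorted_maps_def compatible_values_def)
  next
    fix vs assume vs: "vs \<in> compatible_values (map w xs) t"
    \<comment> \<open>The preimage of \<open>vs\<close> assigns its entries to the vertices by
      position, unambiguously since \<open>xs\<close> is distinct; \<open>restrict\<close> makes it
      extensional.\<close>
    define f where "f = restrict (the \<circ> map_of (zip xs vs)) (set xs)"
    have len: "length vs = length xs"
      using vs by (simp add: compatible_values_def)
    have map: "map f xs = vs"
      using len assms by (intro nth_equalityI) (auto simp: f_def map_of_zip_nth)
    have "set vs = f ` set xs"
      by (simp flip: map)
    moreover have "f \<in> set xs \<rightarrow>\<^sub>E UNIV"
      by (simp add: f_def)
    ultimately have "f \<in> sorted_maps w xs t"
      using vs zip[of f] by (simp add: sorted_maps_def compatible_values_def map)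
    then show "vs \<in> (\<lambda>f. map f xs) ` sorted_maps w xs t"
      using map by (intro image_eqI[of _ _ f]) auto
  qed
  ultimately show ?thesis
    by (simp add: bij_betw_def)
qed

section \<open>Type B partitions as monotone keys\<close>

lemma ex_root_above:
  assumes "x \<in> vertices F"
  shows "\<exists>r \<in> roots F. forest_le F x r"
proof -
  from assms obtain i p where x: "x = i # p" and i: "i < length F"
    unfolding vertices_def by (auto elim: is_vertex.cases)
  then have "forest_le F x [i]"
    using assms by (auto simp: forest_le_def forest_less_def vertices_def strict_prefix_def
        intro: is_vertex.root)
  then show ?thesis
    using i by (auto simp: roots_def)
qed

text \<open>For comparable vertices, the weak and strict conditions together are one lexicographic
  comparison. The root condition bounds root keys by \<open>(0, 0)\<close>, and monotonicity carries
  this bound down from a root above each vertex.\<close>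

lemma type_B_partitions_iff_vertex_key:
  "f \<in> type_B_partitions F w \<longleftrightarrow> f \<in> vertices F \<rightarrow>\<^sub>E UNIV \<and>
    (\<forall>x y. forest_less F y x \<longrightarrow> vertex_key w f y \<le> vertex_key w f x) \<and>
    (\<forall>x \<in> vertices F. vertex_key w f x \<le> (0, 0))" (is "_ \<longleftrightarrow> ?R")
proof
  assume f: "f \<in> type_B_partitions F w"
  have mono: "vertex_key w f y \<le> vertex_key w f x" if "forest_less F y x" for x y
  proof -
    have "f x \<le> f y" "w x < w y \<longrightarrow> f x < f y"
      using f that by (auto simp: type_B_partitions_def forest_le_def forest_less_def)
    then show ?thesis
      by (auto simp: vertex_key_def)
  qed
  have "vertex_key w f x \<le> (0, 0)" if "x \<in> vertices F" for x
  proof -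
    obtain r where r: "r \<in> roots F" "forest_le F x r"
      using ex_root_above \<open>x \<in> vertices F\<close> by blast
    then have "vertex_key w f x \<le> vertex_key w f r"
      using mono by (auto simp: forest_le_def)
    also have "w r > 0 \<longrightarrow> f r \<ge> 1"
      using f r by (auto simp: type_B_partitions_def)
    then have "vertex_key w f r \<le> (0, 0)"
      by (auto simp: vertex_key_def)
    finally show ?thesis .
  qed
  then show ?R
    using f mono by (auto simp: type_B_partitions_def)
next
  assume R: ?R
  have less: "f x \<le> f y \<and> (w x < w y \<longrightarrow> f x < f y)" if "forest_less F y x" for x y
    using R that by (fastforce simp: vertex_key_def)
  have "f x \<ge> 1" if "x \<in> roots F" "w x > 0" for x
  proof -
    have "x \<in> vertices F"
      using that by (auto simp: roots_eq_maximal)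
    then have "vertex_key w f x \<le> (0, 0)"
      using R by blast
    then show ?thesis
      using that(2) by (auto simp: vertex_key_def)
  qed
  then show "f \<in> type_B_partitions F w"
    using R less by (auto simp: type_B_partitions_def forest_le_def)
qed

lemma finite_linear_extensions: "finite (linear_extensions F)"
  by (rule finite_subset[OF _ finite_subset_distinct[OF finite_vertices[of F]]])
    (auto simp: linear_extensions_def)

lemma Omega_eq_sum_sorted_maps:
  assumes inj: "inj_on w (vertices F)"
  shows "Omega F w t = (\<Sum>xs \<in> linear_extensions F. card (sorted_maps w xs t))"
proof -
  have inj_key: "inj_on (vertex_key w f) (vertices F)" for f
    using inj by (auto simp: inj_on_def vertex_key_def)
  have "{f \<in> type_B_partitions F w. \<forall>x \<in> vertices F. f x \<le> t} =
    (\<Union>xs \<in> linear_extensions F. sorted_maps w xs t)"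
  proof (intro equalityI subsetI)
    fix f assume "f \<in> {f \<in> type_B_partitions F w. \<forall>x \<in> vertices F. f x \<le> t}"
    then have f: "f \<in> vertices F \<rightarrow>\<^sub>E UNIV" "\<forall>x \<in> vertices F. f x \<le> t"
      and mono: "\<And>x y. forest_less F y x \<Longrightarrow> vertex_key w f y \<le> vertex_key w f x"
      and bound: "\<forall>x \<in> vertices F. vertex_key w f x \<le> (0, 0)"
      using type_B_partitions_iff_vertex_key by blast+
    obtain ys where ys: "distinct ys" "set ys = vertices F"
      using finite_distinct_list[OF finite_vertices] by blast
    \<comment> \<open>Sorting by key yields the linear extension that \<open>f\<close> belongs
      to.\<close>
    define xs where "xs = sort_key (vertex_key w f) ys"
    have xs: "distinct xs" "set xs = vertices F" "sorted (map (vertex_key w f) xs)"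
      using ys by (simp_all add: xs_def)
    have "j < k" if "j < length xs" "k < length xs" "forest_less F (xs ! j) (xs ! k)" for j k
    proof (rule ccontr)
      assume "\<not> j < k"
      \<comment> \<open>Sorting and forest monotonicity now give opposite inequalities, so the keys
        agree; injectivity then identifies two vertices that are strictly related.\<close>
      then have "vertex_key w f (xs ! k) \<le> vertex_key w f (xs ! j)"
        using that(1,2) xs(3) sorted_nth_mono[of "map (vertex_key w f) xs" k j] by simp
      then have "vertex_key w f (xs ! j) = vertex_key w f (xs ! k)"
        using mono[OF that(3)] by simp
      then have "xs ! j = xs ! k"
        using inj_key[of f] that by (auto simp: inj_on_def forest_less_def)
      then show False
        using that(3) by (simp add: forest_less_def)
    qed
    then have "xs \<in> linear_extensions F"
      using xs by (simp add: linear_extensions_def)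
    moreover have "f \<in> sorted_maps w xs t"
      using f bound xs by (auto simp: sorted_maps_def sorted_append)
    ultimately show "f \<in> (\<Union>xs \<in> linear_extensions F. sorted_maps w xs t)"
      by blast
  next
    fix f assume "f \<in> (\<Union>xs \<in> linear_extensions F. sorted_maps w xs t)"
    then obtain xs where xs: "xs \<in> linear_extensions F" and f: "f \<in> sorted_maps w xs t"
      by blast
    have set: "set xs = vertices F"
      using xs by (simp add: linear_extensions_def)
    have "vertex_key w f y \<le> vertex_key w f x" if "forest_less F y x" for x y
    proof -
      have "y \<in> set xs" "x \<in> set xs"
        using that set by (simp_all add: forest_less_def)
      then obtain j k where jk: "j < length xs" "k < length xs" "y = xs ! j" "x = xs ! k"
        unfolding in_set_conv_nth by blast
      then have "j < k"
        using that xs unfolding linear_extensions_def by blast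
      then show ?thesis
        using f jk sorted_nth_mono[of "map (vertex_key w f) xs" j k]
        by (simp add: sorted_maps_def sorted_append)
    qed
    then have "f \<in> type_B_partitions F w"
      using f set by (subst type_B_partitions_iff_vertex_key)
        (auto simp: sorted_maps_def sorted_append)
    then show "f \<in> {f \<in> type_B_partitions F w. \<forall>x \<in> vertices F. f x \<le> t}"
      using f set by (auto simp: sorted_maps_def)
  qed
  moreover have "sorted_maps w xs t \<inter> sorted_maps w ys t = {}"
    if "xs \<in> linear_extensions F" "ys \<in> linear_extensions F" "xs \<noteq> ys" for xs ys
  proof (rule ccontr)
    assume "sorted_maps w xs t \<inter> sorted_maps w ys t \<noteq> {}"
    then obtain f where f: "f \<in> sorted_maps w xs t" "f \<in> sorted_maps w ys t"
      by blast
    have xy: "distinct xs" "distinct ys" "set xs = vertices F" "set ys = vertices F"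
      using that by (simp_all add: linear_extensions_def)
    \<comment> \<open>A finite set of keys has only one strictly sorted list, so \<open>f\<close>
      determines its ordering.\<close>
    have "map (vertex_key w f) xs = map (vertex_key w f) ys"
      using f xy inj_key[of f]
      by (intro sorted_distinct_set_unique)
        (auto simp: sorted_maps_def sorted_append distinct_map)
    then have "xs = ys"
      using xy inj_key[of f] by (intro map_inj_on[of "vertex_key w f" xs ys]) simp_all
    then show False
      using that(3) by contradiction
  qed
  moreover have "finite (sorted_maps w xs t)" if "xs \<in> linear_extensions F" for xs
    using that bij_betw_finite[OF bij_betw_sorted_maps, of xs w t]
    by (simp add: linear_extensions_def finite_compatible_values)
  ultimately show ?thesis
    unfolding Omega_def by (simp add: card_UN_disjoint finite_linear_extensions)
qed

section \<open>Summation over linear extensions\<close>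

theorem theorem2p4:
  fixes F :: plane_forest and n :: nat and w :: "vertex \<Rightarrow> int"
  assumes "card (vertices F) = n"
    and "signed_labeling F n w"
  shows "(\<Sum>\<sigma> \<in> linear_extension_words F w. fps_X ^ des_B \<sigma>) / (1 - fps_X) ^ (n + 1) =
         (Abs_fps (\<lambda>t. of_nat (Omega F w t)) :: rat fps)"
proof -
  have inj: "inj_on w (vertices F)"
    using assms(2) unfolding signed_labeling_def bij_betw_def inj_on_def by metis
  let ?A = "\<lambda>xs. Abs_fps (\<lambda>t. of_nat (card (compatible_values (map w xs) t)) :: rat)"
  \<comment> \<open>Distinct extensions give distinct words, so the sum over the set of words loses
    no multiplicity.\<close>
  have inj_words: "inj_on (map w) (linear_extensions F)"
  proof (rule inj_onI)
    fix xs ys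
    assume "xs \<in> linear_extensions F" "ys \<in> linear_extensions F" "map w xs = map w ys"
    then show "xs = ys"
      using inj by (intro map_inj_on[of w xs ys]) (simp_all add: linear_extensions_def)
  qed
  have len: "length xs = n" if "xs \<in> linear_extensions F" for xs
    using that assms(1) distinct_card[of xs] by (simp add: linear_extensions_def)
  have "Omega F w t = (\<Sum>xs \<in> linear_extensions F. card (compatible_values (map w xs) t))" for t
    unfolding Omega_eq_sum_sorted_maps[OF inj]
    by (intro sum.cong bij_betw_same_card[OF bij_betw_sorted_maps])
      (auto simp: linear_extensions_def)
  then have "(Abs_fps (\<lambda>t. of_nat (Omega F w t)) :: rat fps) = (\<Sum>xs \<in> linear_extensions F. ?A xs)"
    by (intro fps_ext) (simp add: fps_sum_nth)
  then have "(Abs_fps (\<lambda>t. of_nat (Omega F w t)) :: rat fps) * (1 - fps_X) ^ (n + 1) =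
      (\<Sum>xs \<in> linear_extensions F. ?A xs * (1 - fps_X) ^ (n + 1))"
    by (simp only: sum_distrib_right)
  \<comment> \<open>All words have length \<open>n\<close>, so one common power of
    \<open>1 - fps_X\<close> clears every denominator.\<close>
  also have "\<dots> = (\<Sum>xs \<in> linear_extensions F. fps_X ^ des_B (map w xs))"
  proof (rule sum.cong)
    fix xs assume "xs \<in> linear_extensions F"
    then show "?A xs * (1 - fps_X) ^ (n + 1) = fps_X ^ des_B (map w xs)"
      using compatible_values_fps[of "map w xs", where 'a = rat] len by simp
  qed simp
  also have "\<dots> = (\<Sum>\<sigma> \<in> linear_extension_words F w. fps_X ^ des_B \<sigma>)"
    unfolding linear_extension_words_def by (simp add: sum.reindex[OF inj_words])
  finally have "(\<Sum>\<sigma> \<in> linear_extension_words F w. fps_X ^ des_B \<sigma>) =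
      (Abs_fps (\<lambda>t. of_nat (Omega F w t)) :: rat fps) * (1 - fps_X) ^ (n + 1)" ..
  \<comment> \<open>The constant coefficient is 1, so the power can be cancelled.\<close>
  moreover have "(1 - fps_X :: rat fps) ^ (n + 1) \<noteq> 0"
    by (simp add: fps_eq_iff exI[of _ 0])
  ultimately show ?thesis
    by (metis nonzero_mult_div_cancel_right)
qed

end
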